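(* Let $\rho_2^*=\tfrac12(\sqrt2+\sqrt6)$. Let $\rho\ge\rho_2^*$ and $n\ge2$, and assume either $\lambda>1$, or $0<\lambda<1$ and $n$ is odd. Then $$\min_{z\in\mathcal{E}_\rho}|C_n^\lambda(z)|=\big|C_n^\lambda\big(\pm\tfrac{i}{2}(\rho-\rho^{-1})\big)\big|,$$ i.e. the minimum of $|C_n^\lambda|$ over $\mathcal{E}_\rho$ is attained at the two endpoints of the minor axis.
   Context: $C_n^\lambda$ ($\lambda>-\tfrac12$) is the Gegenbauer polynomial, orthogonal on $[-1,1]$ with respect to $(1-x^2)^{\lambda-1/2}$, normalized by $C_n^\lambda(x)=\frac{\Gamma(\lambda+\frac12)\Gamma(n+2\lambda)}{\Gamma(2\lambda)\Gamma(n+\lambda+\frac12)}P_n^{(\lambda-\frac12,\lambda-\frac12)}(x)$ with $P_n^{(\alpha,\beta)}$ the Jacobi polynomial. The number $\rho_2^*$ is the unique root in $(1,\infty)$ of $\tfrac12(\rho^3+\rho^{-3})-\tfrac32(\rho+\rho^{-1})=0$. The Bernstein ellipse is $\mathcal{E}_\rho=\{\tfrac12(u+u^{-1}): u=\rho e^{i\theta},\ 0\le\theta<2\pi\}$. *)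

theory Defs
  imports "HOL-Analysis.Analysis"
begin

definition jacobiP :: "nat \<Rightarrow> real \<Rightarrow> real \<Rightarrow> complex \<Rightarrow> complex" where
  "jacobiP n a b z =
     (\<Sum>s\<le>n. complex_of_real (((real n + a) gchoose (n - s)) * ((real n + b) gchoose s))
              * ((z - 1) / 2) ^ s * ((z + 1) / 2) ^ (n - s))"

definition gegenbauerC :: "nat \<Rightarrow> real \<Rightarrow> complex \<Rightarrow> complex" where
  "gegenbauerC n lam z =
     complex_of_real (Gamma (lam + 1/2) * Gamma (real n + 2 * lam)
                      / (Gamma (2 * lam) * Gamma (real n + lam + 1/2)))
     * jacobiP n (lam - 1/2) (lam - 1/2) z"

definition bernstein_ellipse :: "real \<Rightarrow> complex set" where
  "bernstein_ellipse rho =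
     (\<lambda>\<theta>. (complex_of_real rho * cis \<theta> + inverse (complex_of_real rho * cis \<theta>)) / 2) ` {0..<2*pi}"

end

(*
The zeros of the Gegenbauer polynomial come in pairs x, -x. For z on the ellipse with
A = (rho^2 + rho^-2)/2 and y = cos (2 theta), a pair with t = x^2 and c = 1 - 2t contributes
|z^2 - t|^2 = (y^2 + 2cAy + c^2 + A^2 - 1)/4, a zero at the origin contributes (A + y)/2, and the
minor axis is y = -1. When A >= 2, which is rho >= rho_2^*, the quotient of the pair factor at y by
the one at y = -1 is increasing in c, hence decreasing in t.

The squared positive zeros satisfy Stieltjes' equilibrium equations, and a maximum principle for
these shows that each of them decreases as lambda grows. So the claim for lambda follows from the
claim for any smaller parameter: lambda = 1 (Chebyshev U) if lambda > 1, and lambda = 0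
(Chebyshev T) if n is odd. Both are explicit in terms of u^n and u^-n, where 2z = u + 1/u.
*)
theory Submission
  imports Defs
begin

section \<open>Rodrigues polynomials and their zeros\<close>

text \<open>The condition A >= 2 is the definition of rho_2^* in disguise: dividing rho^3 + rho^-3 =
  3 (rho + rho^-1) by rho + rho^-1 leaves rho^2 + rho^-2 = 4. It serves both the pair factors and
  Chebyshev U. Parity restricts the other base case: on the minor axis |u^n + u^-n| is smallest for
  odd n but largest for even n. Moreover lambda = 0 lies outside the normalization of C_n^lambda,
  since Gamma (2 lambda) has a pole there; all comparisons therefore concern the unnormalized Jacobi
  sum. The real zeros and the differential equation come from one source:
  \<open>rodrigues a k\<close> is the polynomial p_k with (d/dx)^k (x^2 - 1)^a = (x^2 - 1)^(a - k)
  p_k. Here a = n + lambda - 1/2 stays fixed while k grows, and the Gegenbauer exponent lambda - 1/2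
  is reached at k = n.\<close>

fun rodrigues :: "real \<Rightarrow> nat \<Rightarrow> real poly" where
  "rodrigues a 0 = 1"
| "rodrigues a (Suc k) = [:-1, 0, 1:] * pderiv (rodrigues a k) + smult (2 * (a - real k)) ([:0, 1:] * rodrigues a k)"

text \<open>Replaces the Leibniz rule applied to (x^2 - 1) f' = 2 a x f with f = (x^2 - 1)^a.
  Lowering the index at fixed a is what turns the first-order recursion into a second-order
  equation.\<close>

lemma pderiv_rodrigues_Suc:
  "pderiv (rodrigues a (Suc k)) = smult (real (Suc k) * (2 * a - real k)) (rodrigues a k)"
proof (induction k)
  case 0
  show ?case by (simp add: pderiv_pCons pderiv_mult pderiv_smult)
next
  case (Suc k)
  let ?c = "real (Suc k) * (2 * a - real k)"
  let ?p = "rodrigues a (Suc k)" and ?q = "rodrigues a k"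
  have X: "[:-1, 0, 1:] * pderiv ?q = ?p - smult (2 * (a - real k)) ([:0, 1:] * ?q)" by simp
  have p': "pderiv ?p = smult ?c ?q" by (rule Suc.IH)
  \<comment> \<open>The induction hypothesis makes p'' a multiple of q', and the recursion
    \<open>X\<close> trades q' for p and q.\<close>
  have p'': "[:-1, 0, 1:] * pderiv (pderiv ?p)
      = smult ?c (?p - smult (2 * (a - real k)) ([:0, 1:] * ?q))"
    unfolding p' pderiv_smult by (metis X mult_smult_right)
  have "pderiv (rodrigues a (Suc (Suc k))) =
     [:-1, 0, 1:] * pderiv (pderiv ?p) + [:0, 2:] * pderiv ?p
     + smult (2 * (a - real (Suc k))) ([:0, 1:] * pderiv ?p + ?p)"
    unfolding rodrigues.simps(2)[of a "Suc k"] pderiv_add pderiv_smult pderiv_mult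
    by (intro poly_ext) (simp add: pderiv_pCons algebra_simps del: rodrigues.simps)
  also have "\<dots> = smult (real (Suc (Suc k)) * (2 * a - real (Suc k))) ?p"
    unfolding p'' unfolding p'
    by (rule poly_ext) (simp add: algebra_simps del: rodrigues.simps)
  finally show ?case .
qed

text \<open>Gegenbauer's equation: for a = n + lam - 1/2 the constants are 2 lam + 1 and n (n + 2
  lam). It is the recursion from k to k + 1, scaled so that the lower polynomial becomes the
  derivative of the upper one.\<close>

lemma rodrigues_ode:
  "[:-1, 0, 1:] * pderiv (pderiv (rodrigues a n)) + smult (2 * (a - real n + 1)) ([:0, 1:] * pderiv (rodrigues a n))
   = smult (real n * (2 * a - real n + 1)) (rodrigues a n)"
proof (cases n)
  case 0
  then show ?thesis by simp
next
  case (Suc k)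
  let ?c = "real (Suc k) * (2 * a - real k)" and ?q = "rodrigues a k"
  have "[:-1, 0, 1:] * pderiv (pderiv (rodrigues a n)) + smult (2 * (a - real n + 1)) ([:0, 1:] * pderiv (rodrigues a n))
     = smult ?c ([:-1, 0, 1:] * pderiv ?q + smult (2 * (a - real k)) ([:0, 1:] * ?q))"
    unfolding Suc pderiv_rodrigues_Suc pderiv_smult
    by (rule poly_ext) (simp add: algebra_simps del: rodrigues.simps)
  also have "\<dots> = smult ?c (rodrigues a (Suc k))"
    by simp
  finally have "[:-1, 0, 1:] * pderiv (pderiv (rodrigues a n)) + smult (2 * (a - real n + 1)) ([:0, 1:] * pderiv (rodrigues a n))
     = smult ?c (rodrigues a (Suc k))" .
  then show ?thesis by (simp add: Suc del: rodrigues.simps)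
qed

lemma degree_rodrigues: "degree (rodrigues a n) \<le> n"
proof (induction n)
  case (Suc n)
  show ?case
  proof (cases "n = 0")
    case False
    have "degree ([:-1, 0, 1:] * pderiv (rodrigues a n)) \<le> 2 + (n - 1)"
      by (rule order.trans[OF degree_mult_le]) (use Suc in \<open>auto simp: degree_pderiv\<close>)
    moreover have "degree (smult (2 * (a - real n)) ([:0, 1:] * rodrigues a n)) \<le> 1 + n"
      by (rule order.trans[OF degree_smult_le], rule order.trans[OF degree_mult_le]) (use Suc in auto)
    ultimately show ?thesis using False by (auto intro!: degree_add_le)
  qed (simp add: degree_mult_le)
qed simp

section \<open>Explicit expansion of the Rodrigues polynomials\<close>

lemma gbinomial_Suc_mult: "real (Suc k) * (a gchoose Suc k) = (a - real k) * (a gchoose k)"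
  using gbinomial_mult_1[of a k] by (simp add: algebra_simps)

text \<open>This is 2^n times the Jacobi polynomial with both parameters a - n. The type is generic
  because zeros are found over the reals and moduli taken over the complex numbers.\<close>

definition jacobi_sum :: "nat \<Rightarrow> real \<Rightarrow> 'a::real_normed_field \<Rightarrow> 'a" where
  "jacobi_sum n a z = (\<Sum>s\<le>n. of_real ((a gchoose s) * (a gchoose (n - s))) * (z - 1) ^ s * (z + 1) ^ (n - s))"

text \<open>The Leibniz rule for the n-th derivative of (x - 1)^a (x + 1)^a, carried out on
  polynomials only.\<close>

lemma rodrigues_eq_sum:
  "rodrigues a n = smult (fact n) (\<Sum>s\<le>n. smult ((a gchoose s) * (a gchoose (n - s))) ([:-1, 1:] ^ s * [:1, 1:] ^ (n - s)))"
proof (induction n)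
  case 0
  then show ?case by (simp add: one_pCons)
next
  case (Suc n)
  let ?X = "[:-1, 1:] :: real poly" and ?Y = "[:1, 1:] :: real poly"
  let ?g = "\<lambda>s. a gchoose s"
  let ?t = "\<lambda>m s. smult (?g s * ?g (m - s)) (?X ^ s * ?Y ^ (m - s))"
  have XY: "[:-1, 0, 1:] = ?X * ?Y" and Z: "smult 2 [:0, 1:] = ?X + ?Y" by simp_all
  \<comment> \<open>Each term of level n feeds two terms of level n + 1: s with weight n + 1 - s,
    and s + 1 with weight s + 1. Collected, every term has weight n + 1, which extends the
    factorial.\<close>
  have step: "?X * ?Y * pderiv (?t n s) + smult (a - real n) ((?X + ?Y) * ?t n s)
      = smult (real (Suc n - s)) (?t (Suc n) s) + smult (real (Suc s)) (?t (Suc n) (Suc s))"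
    (is "?l = ?r") if s: "s \<le> n" for s
  proof -
    have dX: "?X * pderiv (?X ^ s) = smult (real s) (?X ^ s)" for s
      by (cases s) (simp_all add: pderiv_power_Suc pderiv_pCons del: power_Suc, simp add: algebra_simps)
    have dY: "?Y * pderiv (?Y ^ s) = smult (real s) (?Y ^ s)" for s
      by (cases s) (simp_all add: pderiv_power_Suc pderiv_pCons del: power_Suc, simp add: algebra_simps)
    have pd: "?X * ?Y * pderiv (?t n s) = smult (?g s * ?g (n - s))
       (?X * ?X ^ s * (?Y * pderiv (?Y ^ (n - s))) + ?Y * ?Y ^ (n - s) * (?X * pderiv (?X ^ s)))"
      by (simp add: pderiv_smult pderiv_mult algebra_simps del: mult_pCons_left mult_pCons_right)
    have "?l = smult (?g s * ((a - real (n - s)) * ?g (n - s))) (?X ^ s * ?Y ^ (Suc n - s))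
       + smult (((a - real s) * ?g s) * ?g (n - s)) (?X ^ Suc s * ?Y ^ (n - s))"
      unfolding pd dX dY using s
      by (intro poly_ext) (simp add: Suc_diff_le of_nat_diff algebra_simps)
    also have "\<dots> = ?r"
      unfolding gbinomial_Suc_mult[symmetric] using s
      by (simp add: Suc_diff_le mult_ac)
    finally show ?thesis .
  qed
  let ?S = "\<lambda>m. \<Sum>s\<le>m. ?t m s"
  have smult_sum_right: "smult c (sum f A) = (\<Sum>s\<in>A. smult c (f s))" for c and f :: "nat \<Rightarrow> real poly" and A
    by (induction A rule: infinite_finite_induct) (simp_all add: smult_add_right)
  have pd_sum: "pderiv (sum f A) = (\<Sum>s\<in>A. pderiv (f s))" for f :: "nat \<Rightarrow> real poly" and A
    by (induction A rule: infinite_finite_induct) (simp_all add: pderiv_add)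
  have "?X * ?Y * pderiv (?S n) + smult (a - real n) ((?X + ?Y) * ?S n)
     = (\<Sum>s\<le>n. ?X * ?Y * pderiv (?t n s) + smult (a - real n) ((?X + ?Y) * ?t n s))"
    by (simp only: pd_sum sum_distrib_left sum.distrib smult_sum_right)
  also have "\<dots> = (\<Sum>s\<le>n. smult (real (Suc n - s)) (?t (Suc n) s)) + (\<Sum>s\<le>n. smult (real (Suc s)) (?t (Suc n) (Suc s)))"
    by (simp only: sum.distrib[symmetric]) (rule sum.cong, use step in auto)
  also have "(\<Sum>s\<le>n. smult (real (Suc s)) (?t (Suc n) (Suc s))) = (\<Sum>s\<le>Suc n. smult (real s) (?t (Suc n) s))"
    by (subst sum.atMost_Suc_shift) simp
  also have "(\<Sum>s\<le>n. smult (real (Suc n - s)) (?t (Suc n) s)) = (\<Sum>s\<le>Suc n. smult (real (Suc n - s)) (?t (Suc n) s))"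
    by simp
  also have "(\<Sum>s\<le>Suc n. smult (real (Suc n - s)) (?t (Suc n) s)) + (\<Sum>s\<le>Suc n. smult (real s) (?t (Suc n) s))
      = smult (real (Suc n)) (?S (Suc n))"
    unfolding sum.distrib[symmetric] smult_add_left[symmetric] smult_sum_right
    by (rule sum.cong) (auto simp: of_nat_diff)
  finally have main: "?X * ?Y * pderiv (?S n) + smult (a - real n) ((?X + ?Y) * ?S n) = smult (real (Suc n)) (?S (Suc n))" .
  have "rodrigues a (Suc n) = ?X * ?Y * pderiv (rodrigues a n) + smult (a - real n) ((?X + ?Y) * rodrigues a n)"
    unfolding rodrigues.simps(2) XY Z[symmetric] by (simp add: mult_ac)
  also have "\<dots> = smult (fact n) (?X * ?Y * pderiv (?S n) + smult (a - real n) ((?X + ?Y) * ?S n))"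
    unfolding Suc.IH pderiv_smult by (intro poly_ext) (simp add: algebra_simps)
  finally show ?case unfolding main by (simp add: mult.commute)
qed

lemma poly_rodrigues: "poly (rodrigues a n) x = fact n * jacobi_sum n a x"
  unfolding rodrigues_eq_sum jacobi_sum_def
  by (simp add: poly_sum mult_ac add.commute)

lemma jacobi_sum_minus: "jacobi_sum n a (- z) = (-1) ^ n * jacobi_sum n a z"
proof -
  have "jacobi_sum n a (- z) = (\<Sum>s\<le>n. of_real ((a gchoose (n - s)) * (a gchoose s)) * (- z - 1) ^ (n - s) * (- z + 1) ^ s)"
    unfolding jacobi_sum_def by (rule sum.reindex_bij_witness[of _ "\<lambda>s. n - s" "\<lambda>s. n - s"]) auto
  also have "\<dots> = (\<Sum>s\<le>n. (-1) ^ n * (of_real ((a gchoose s) * (a gchoose (n - s))) * (z - 1) ^ s * (z + 1) ^ (n - s)))"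
  proof (rule sum.cong)
    fix s assume "s \<in> {..n}"
    then have "(-1) ^ n = (-1) ^ (n - s) * ((-1) ^ s :: 'a)" by (simp add: power_add[symmetric])
    moreover have "(- z - 1) ^ (n - s) = (-1) ^ (n - s) * (z + 1) ^ (n - s)" "(- z + 1) ^ s = (-1) ^ s * (z - 1) ^ s"
      by (simp_all add: power_mult_distrib[symmetric])
    ultimately show "of_real ((a gchoose (n - s)) * (a gchoose s)) * (- z - 1) ^ (n - s) * (- z + 1) ^ s
       = (-1) ^ n * (of_real ((a gchoose s) * (a gchoose (n - s))) * (z - 1) ^ s * (z + 1) ^ (n - s))"
      by (simp add: mult_ac)
  qed simp
  finally show ?thesis by (simp add: jacobi_sum_def sum_distrib_left)
qed

section \<open>Real zeros in the open interval\<close>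

lemma poly_rodrigues_1_pos: "a > real n - 1 \<Longrightarrow> poly (rodrigues a n) 1 > 0"
  by (induction n) auto

lemma rodrigues_roots:
  assumes "a > real n - 1"
  shows "\<exists>x. (\<forall>i<n. x i \<in> {-1<..<1::real} \<and> poly (rodrigues a n) (x i) = 0) \<and> (\<forall>i. Suc i < n \<longrightarrow> x i < x (Suc i))"
  using assms
proof (induction n)
  case 0
  then show ?case by simp
next
  case (Suc n)
  then obtain x where x: "\<And>i. i < n \<Longrightarrow> x i \<in> {-1<..<1::real} \<and> poly (rodrigues a n) (x i) = 0"
      "\<And>i. Suc i < n \<Longrightarrow> x i < x (Suc i)" by force
  define b where "b = a - real n"
  have b: "b > 0" using Suc.prems by (simp add: b_def)
  \<comment> \<open>The derivative of F is a nonvanishing multiple of the next Rodrigues polynomial on the open interval;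
    F also vanishes at both endpoints, so Rolle gives one more zero.\<close>
  define F where "F = (\<lambda>x::real. (1 - x\<^sup>2) powr b * poly (rodrigues a n) x)"
  \<comment> \<open>The old zeros, shifted by one index and framed by -1 and 1. The value 1 for all
    i > n lets the range and vanishing facts hold for every i.\<close>
  define p where "p i = (if i = 0 then -1 else if i \<le> n then x (i - 1) else 1)" for i
  have p_less: "p i < p (Suc i)" if "i \<le> n" for i
    using that x[of "i - 1"] x(1)[of i] by (auto simp: p_def)
  have p_range: "p i \<in> {-1..1}" for i
    using x(1)[of "i - 1"] by (cases i) (auto simp: p_def Suc_le_eq intro: less_imp_le)
  have F0: "F (p i) = 0" for i
    using x(1)[of "i - 1"] b by (auto simp: F_def p_def)
  \<comment> \<open>The minus sign arises because \<open>rodrigues\<close> uses x^2 - 1, while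
    \<open>powr\<close> needs the positive base 1 - x^2.\<close>
  have dF: "(F has_real_derivative - ((1 - x\<^sup>2) powr (b - 1) * poly (rodrigues a (Suc n)) x)) (at x)"
    if "x \<in> {-1<..<1}" for x
  proof -
    have pos: "1 - x\<^sup>2 > 0" using that by (simp add: abs_square_less_1 abs_less_iff)
    have "((1 - x\<^sup>2) powr (b - 1)) * (1 - x\<^sup>2) = (1 - x\<^sup>2) powr b"
      using pos by (simp add: powr_diff)
    note e = this[symmetric]
    show ?thesis unfolding F_def
      apply (rule derivative_eq_intros has_real_derivative_powr' poly_DERIV refl | use pos in force)+
      using pos unfolding e rodrigues.simps
      by (simp add: b_def field_simps power2_eq_square)
  qed
  have "\<exists>z. p i < z \<and> z < p (Suc i) \<and> poly (rodrigues a (Suc n)) z = 0" if i: "i \<le> n" for i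
  proof -
    have sub: "x \<in> {-1..1}" if "x \<in> {p i..p (Suc i)}" for x
      using that p_range[of i] p_range[of "Suc i"] by auto
    have sub': "x \<in> {-1<..<1}" if "p i < x" "x < p (Suc i)" for x
      using that p_range[of i] p_range[of "Suc i"] by auto
    have "continuous_on {p i..p (Suc i)} F"
      unfolding F_def using b sub
      by (intro continuous_on_mult continuous_on_powr' continuous_intros)
         (auto simp: abs_square_le_1 abs_le_iff)
    then obtain z where z: "p i < z" "z < p (Suc i)"
      "(*) (- ((1 - z\<^sup>2) powr (b - 1) * poly (rodrigues a (Suc n)) z)) = (\<lambda>v. 0)"
      using Rolle_deriv[OF p_less[OF i], of F "\<lambda>z. (*) (- ((1 - z\<^sup>2) powr (b - 1) * poly (rodrigues a (Suc n)) z))"]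
        F0 dF[unfolded has_field_derivative_def, OF sub'] by (metis (no_types, lifting))
    from fun_cong[OF z(3), of 1] have "(1 - z\<^sup>2) powr (b - 1) * poly (rodrigues a (Suc n)) z = 0"
      by (simp del: rodrigues.simps)
    moreover have "(1 - z\<^sup>2) > 0" using sub'[OF z(1,2)] by (simp add: abs_square_less_1 abs_less_iff)
    ultimately show ?thesis using z(1,2) by (auto simp del: rodrigues.simps)
  qed
  then obtain y where y: "\<And>i. i \<le> n \<Longrightarrow> p i < y i \<and> y i < p (Suc i) \<and> poly (rodrigues a (Suc n)) (y i) = 0"
    by metis
  have "y i \<in> {-1<..<1}" if "i \<le> n" for i
    using y[OF that] p_range[of i] p_range[of "Suc i"] by auto
  moreover have "y i < y (Suc i)" if "Suc i \<le> n" for i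
    using y[of i] y[OF that] that by auto
  ultimately show ?case using y by (intro exI[of _ y]) (auto simp: less_Suc_eq_le simp del: rodrigues.simps)
qed

text \<open>Degree at most n and n distinct zeros leave only a scalar free. It is nonzero because
  the value at 1 is positive, so no formula for the leading coefficient is required.\<close>

lemma rodrigues_factorization:
  assumes "a > real n - 1"
  obtains R K where "finite R" "R \<subseteq> {-1<..<1}" "card R = n" "K \<noteq> 0"
    "rodrigues a n = smult K (\<Prod>x\<in>R. [:- x, 1:])"
proof -
  obtain x where x: "\<And>i. i < n \<Longrightarrow> x i \<in> {-1<..<1::real} \<and> poly (rodrigues a n) (x i) = 0"
      "\<And>i. Suc i < n \<Longrightarrow> x i < x (Suc i)" using rodrigues_roots[OF assms] by blast
  have less: "x i < x j" if "i < j" "j < n" for i j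
    using that
  proof (induction j)
    case (Suc j)
    then show ?case using x(2)[of j] by (cases "i = j") auto
  qed simp
  define R where "R = x ` {..<n}"
  have inj: "inj_on x {..<n}"
    by (rule linorder_inj_onI) (use less in force)+
  define K where "K = poly.coeff (rodrigues a n) n"
  have fin: "finite R" and card: "card R = n"
    using inj by (auto simp: R_def card_image)
  have deg: "degree (\<Prod>x\<in>R. [:- x, 1:]) = n"
    by (subst degree_prod_eq_sum_degree) (simp_all add: card)
  have "lead_coeff (\<Prod>x\<in>R. [:- x, 1:]) = 1"
    by (simp add: lead_coeff_prod)
  then have coeff: "poly.coeff (\<Prod>x\<in>R. [:- x, 1:]) n = 1"
    by (simp only: deg)
  have zero: "poly (rodrigues a n) z = 0" "poly (\<Prod>x\<in>R. [:- x, 1:]) z = 0" if "z \<in> R" for z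
    using that x(1) fin by (auto simp: R_def poly_prod)
  have eq: "rodrigues a n = smult K (\<Prod>x\<in>R. [:- x, 1:])"
    using degree_rodrigues[of a n]
    by (intro poly_eqI_degree_lead_coeff[of _ n _ R]) (simp_all add: K_def deg card coeff zero)
  moreover have "K \<noteq> 0"
    using poly_rodrigues_1_pos[OF assms] eq by auto
  ultimately show ?thesis using that[of R K] fin card x(1) by (auto simp: R_def image_subset_iff)
qed

lemma poly_pderiv_at_root:
  fixes R :: "real set"
  assumes "finite R" "c \<in> R" "K \<noteq> 0" and p: "p = smult K (\<Prod>x\<in>R. [:- x, 1:])"
  shows "poly (pderiv p) c \<noteq> 0"
    and "poly (pderiv (pderiv p)) c = 2 * poly (pderiv p) c * (\<Sum>x\<in>R - {c}. 1 / (c - x))"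
proof -
  define g where "g = (\<Prod>x\<in>R - {c}. [:- x, 1:])"
  \<comment> \<open>With p = K (X - c) g one has p'(c) = K g(c) and p''(c) = 2 K g'(c); the sum is
    the logarithmic derivative of g at c.\<close>
  have p_eq: "p = smult K ([:- c, 1:] * g)"
    unfolding p g_def using assms by (subst prod.remove[of R c]) auto
  have p': "pderiv p = smult K (g + [:- c, 1:] * pderiv g)"
    unfolding p_eq pderiv_smult pderiv_mult by (simp add: pderiv_pCons add.commute)
  have p'': "pderiv (pderiv p) = smult K (2 * pderiv g + [:- c, 1:] * pderiv (pderiv g))"
    unfolding p' pderiv_smult pderiv_add pderiv_mult by (simp add: pderiv_pCons)
  have g0: "poly g c \<noteq> 0" using assms by (auto simp: g_def poly_prod)
  have "poly (pderiv g) c = (\<Sum>x\<in>R - {c}. poly (\<Prod>y\<in>R - {c} - {x}. [:- y, 1:]) c)"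
    unfolding g_def pderiv_prod by (simp add: poly_sum pderiv_pCons)
  also have "\<dots> = (\<Sum>x\<in>R - {c}. poly g c * (1 / (c - x)))"
  proof (rule sum.cong)
    fix x assume x: "x \<in> R - {c}"
    then have "poly g c = (c - x) * poly (\<Prod>y\<in>R - {c} - {x}. [:- y, 1:]) c"
      unfolding g_def using assms by (subst prod.remove[of "R - {c}" x]) (auto simp: algebra_simps)
    then show "poly (\<Prod>y\<in>R - {c} - {x}. [:- y, 1:]) c = poly g c * (1 / (c - x))" using x by auto
  qed simp
  finally have "poly (pderiv g) c = poly g c * (\<Sum>x\<in>R - {c}. 1 / (c - x))"
    by (simp add: sum_distrib_left)
  then show "poly (pderiv (pderiv p)) c = 2 * poly (pderiv p) c * (\<Sum>x\<in>R - {c}. 1 / (c - x))"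
    unfolding p'' unfolding p' by simp
  show "poly (pderiv p) c \<noteq> 0" using g0 \<open>K \<noteq> 0\<close> by (simp add: p')
qed

text \<open>Zeros x' and -x' act on x together through 1/(x - x') + 1/(x + x') = 2x/(x^2 - x'^2), so
  division by 2x closes the equilibrium equations in t = x^2. The mirror image of x itself leaves
  1/4 as a charge at 0, and a zero at the origin leaves 1/2.\<close>

lemma gegenbauer_factorization:
  assumes lam: "lam > -1/2"
  obtains T K where "finite T" "T \<subseteq> {0<..<1}" "card T = n div 2" "K \<noteq> 0"
    "\<And>z::complex. jacobi_sum n (real n + lam - 1/2) z = of_real K * z ^ (n mod 2) * (\<Prod>t\<in>T. z\<^sup>2 - of_real t)"
    "\<And>t. t \<in> T \<Longrightarrow> (\<Sum>s\<in>T - {t}. 1 / (t - s)) = (lam + 1/2) / 2 / (1 - t) - (1/4 + real (n mod 2) / 2) / t"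
proof -
  define a where "a = real n + lam - 1/2"
  have a: "a > real n - 1" using lam by (simp add: a_def)
  obtain R K where R: "finite R" "R \<subseteq> {-1<..<1}" "card R = n" and K: "K \<noteq> 0"
    and fac: "rodrigues a n = smult K (\<Prod>x\<in>R. [:- x, 1:])"
    using rodrigues_factorization[OF a] by blast
  have root_iff: "x \<in> R \<longleftrightarrow> poly (rodrigues a n) x = 0" for x
    using R(1) K by (auto simp: fac poly_prod)
  have sym: "- x \<in> R" if "x \<in> R" for x
    using that unfolding root_iff poly_rodrigues jacobi_sum_minus by simp
  have equil: "(\<Sum>x\<in>R - {c}. 1 / (c - x)) = (lam + 1/2) * c / (1 - c\<^sup>2)" if c: "c \<in> R" for c
  proof -
    let ?D = "poly (pderiv (rodrigues a n)) c" and ?S = "\<Sum>x\<in>R - {c}. 1 / (c - x)"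
    have "(c\<^sup>2 - 1) * poly (pderiv (pderiv (rodrigues a n))) c + 2 * (a - real n + 1) * (c * ?D) = 0"
      using arg_cong[OF rodrigues_ode[of a n], of "\<lambda>p. poly p c"] c
      by (simp add: root_iff power2_eq_square algebra_simps)
    then have "?D * ((c\<^sup>2 - 1) * ?S + (a - real n + 1) * c) = 0"
      unfolding poly_pderiv_at_root(2)[OF R(1) c K fac] by (simp add: algebra_simps)
    then have "(c\<^sup>2 - 1) * ?S + (a - real n + 1) * c = 0"
      using poly_pderiv_at_root(1)[OF R(1) c K fac] by simp
    moreover have "1 - c\<^sup>2 > 0" using c R(2) by (auto simp: abs_square_less_1 abs_less_iff)
    ultimately show ?thesis by (simp add: a_def field_simps)
  qed
  define P where "P = {x\<in>R. x > 0}"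
  have finP: "finite P" using R(1) by (simp add: P_def)
  have R_eq: "R = P \<union> uminus ` P \<union> (R \<inter> {0})"
  proof -
    have "x \<in> uminus ` P" if "x \<in> R" "x < 0" for x
      using sym[OF that(1)] that(2) by (intro image_eqI[of _ _ "-x"]) (auto simp: P_def)
    then show ?thesis using sym by (auto simp: P_def) (metis linorder_neqE_linordered_idom)
  qed
  have disj: "P \<inter> uminus ` P = {}" "(P \<union> uminus ` P) \<inter> (R \<inter> {0}) = {}" by (auto simp: P_def)
  \<comment> \<open>Counting decides whether 0 is a zero: n = 2 |P| + e with e at most 1 forces e to
    be the parity of n.\<close>
  define e where "e = card (R \<inter> {0})"
  have "n = 2 * card P + e"
    unfolding R(3)[symmetric] e_def using R(1)
    by (subst R_eq) (simp add: card_Un_disjoint finP disj card_image)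
  moreover have "e \<le> 1" unfolding e_def by (rule order.trans[OF card_mono[of "{0}"]]) auto
  ultimately have n: "card P = n div 2" "e = n mod 2" by auto
  have e_cases: "(e = 0 \<and> R \<inter> {0} = {}) \<or> (e = 1 \<and> R \<inter> {0} = {0})"
    unfolding e_def by (cases "0 \<in> R") auto
  define T where "T = (\<lambda>x. x\<^sup>2) ` P"
  have injP: "inj_on (\<lambda>x. x\<^sup>2) P" by (auto simp: inj_on_def P_def)
  show ?thesis
  proof (rule that[of T "K / fact n"])
    show "finite T" "K / fact n \<noteq> 0" using finP K by (auto simp: T_def)
    show "T \<subseteq> {0<..<1}" using R(2) by (auto simp: T_def P_def abs_square_less_1)
    show "card T = n div 2" unfolding T_def n(1)[symmetric] by (rule card_image[OF injP])
  next
    fix z :: complex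
    \<comment> \<open>The real factorization passes to complex z because f and g agree at the
      infinitely many real points.\<close>
    define f where "f = smult (of_real (fact n)) (\<Sum>s\<le>n. smult (of_real ((a gchoose s) * (a gchoose (n - s))) :: complex) ([:-1, 1:] ^ s * [:1, 1:] ^ (n - s)))"
    define g where "g = smult (of_real K) (\<Prod>x\<in>R. [:- of_real x, 1:] :: complex poly)"
    have f: "poly f z = fact n * jacobi_sum n a z" for z
      by (simp add: f_def jacobi_sum_def poly_sum add.commute mult_ac)
    have "poly (f - g) (of_real x) = 0" for x
    proof -
      have "jacobi_sum n a (of_real x) = (of_real (jacobi_sum n a x) :: complex)"
        by (simp add: jacobi_sum_def)
      then have "poly f (of_real x) = of_real (poly (rodrigues a n) x)"
        by (simp add: f poly_rodrigues)
      also have "\<dots> = poly g (of_real x)"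
        by (simp add: g_def fac poly_prod)
      finally show ?thesis by simp
    qed
    then have "range of_real \<subseteq> {z. poly (f - g) z = 0}" by auto
    moreover have "infinite (range (of_real :: real \<Rightarrow> complex))"
      using infinite_UNIV_char_0 finite_imageD[OF _ inj_of_real] by blast
    ultimately have "f - g = 0"
      using poly_roots_finite finite_subset by blast
    then have "fact n * jacobi_sum n a z = poly g z" using f by simp
    also have "poly g z = of_real K * (\<Prod>x\<in>P \<union> uminus ` P \<union> (R \<inter> {0}). z - of_real x)"
      by (subst R_eq[symmetric]) (simp add: g_def poly_prod)
    also have "(\<Prod>x\<in>P \<union> uminus ` P \<union> (R \<inter> {0}). z - of_real x)
      = ((\<Prod>x\<in>P. z - of_real x) * (\<Prod>x\<in>P. z + of_real x)) * z ^ (n mod 2)"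
      using e_cases disj finP by (subst prod.union_disjoint) (auto simp: prod.union_disjoint prod.reindex n(2)[symmetric])
    also have "(\<Prod>x\<in>P. z - of_real x) * (\<Prod>x\<in>P. z + of_real x) = (\<Prod>t\<in>T. z\<^sup>2 - of_real t)"
      unfolding T_def prod.reindex[OF injP] prod.distrib[symmetric]
      by (rule prod.cong) (auto simp: power2_eq_square algebra_simps)
    finally show "jacobi_sum n (real n + lam - 1/2) z = of_real (K / fact n) * z ^ (n mod 2) * (\<Prod>t\<in>T. z\<^sup>2 - of_real t)"
      by (simp add: a_def field_simps)
  next
    fix t assume "t \<in> T"
    then obtain c where c: "c \<in> P" "t = c\<^sup>2" by (auto simp: T_def)
    have c0: "c > 0" "c \<in> R" "c < 1" using c R(2) by (auto simp: P_def)
    have t: "t > 0" "t < 1" using c0 by (auto simp: c(2) abs_square_less_1)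
    have Rc: "R - {c} = (P - {c}) \<union> uminus ` P \<union> (R \<inter> {0})"
      using c0(1) by (subst R_eq) (auto simp: P_def)
    have "(\<Sum>x\<in>R - {c}. 1 / (c - x)) = (\<Sum>x\<in>P - {c}. 1 / (c - x)) + (\<Sum>x\<in>uminus ` P. 1 / (c - x)) + (\<Sum>x\<in>R \<inter> {0}. 1 / (c - x))"
    proof -
      have "(P - {c}) \<inter> uminus ` P = {}" "((P - {c}) \<union> uminus ` P) \<inter> (R \<inter> {0}) = {}"
        using disj by auto
      then show ?thesis
        unfolding Rc using finP R(1) by (simp add: sum.union_disjoint)
    qed
    also have "(\<Sum>x\<in>R \<inter> {0}. 1 / (c - x)) = real e / c"
      using e_cases by (elim disjE conjE) (simp_all only: sum.empty, simp_all)
    also have "(\<Sum>x\<in>uminus ` P. 1 / (c - x)) = (\<Sum>x\<in>P. 1 / (c + x))" by (simp add: sum.reindex)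
    also have "\<dots> = 1 / (2 * c) + (\<Sum>x\<in>P - {c}. 1 / (c + x))"
      using c finP by (subst sum.remove[of P c]) auto
    finally have "(lam + 1/2) * c / (1 - c\<^sup>2) = (\<Sum>x\<in>P - {c}. 1 / (c - x) + 1 / (c + x)) + 1 / (2 * c) + real e / c"
      using equil[OF c0(2)] by (simp add: sum.distrib)
    also have "(\<Sum>x\<in>P - {c}. 1 / (c - x) + 1 / (c + x)) = (\<Sum>x\<in>P - {c}. 2 * c * (1 / (c\<^sup>2 - x\<^sup>2)))"
    proof (rule sum.cong)
      fix x assume x: "x \<in> P - {c}"
      then have "c - x \<noteq> 0" "c + x \<noteq> 0" using c0 by (auto simp: P_def)
      moreover have "c\<^sup>2 - x\<^sup>2 = (c - x) * (c + x)" by (simp add: power2_eq_square algebra_simps)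
      ultimately show "1 / (c - x) + 1 / (c + x) = 2 * c * (1 / (c\<^sup>2 - x\<^sup>2))"
        by (simp add: divide_simps)
    qed simp
    also have "\<dots> = 2 * c * (\<Sum>s\<in>T - {t}. 1 / (t - s))"
    proof -
      have "T - {t} = (\<lambda>x. x\<^sup>2) ` (P - {c})"
        using injP c by (auto simp: T_def inj_on_def)
      then show ?thesis
        by (simp add: sum.reindex[OF inj_on_subset[OF injP]] c(2) sum_distrib_left)
    qed
    finally have "2 * c * (\<Sum>s\<in>T - {t}. 1 / (t - s)) = (lam + 1/2) * c / (1 - t) - (1 / (2 * c) + real e / c)"
      by (simp add: c(2))
    then have "(\<Sum>s\<in>T - {t}. 1 / (t - s)) = ((lam + 1/2) * c / (1 - t) - (1 / (2 * c) + real e / c)) / (2 * c)"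
      using c0 by (simp add: field_simps)
    also have "\<dots> = (lam + 1/2) / 2 / (1 - t) - (1/4 + real e / 2) / t"
      using c0 t by (simp add: c(2) diff_divide_distrib add_divide_distrib power2_eq_square ac_simps)
    finally show "(\<Sum>s\<in>T - {t}. 1 / (t - s)) = (lam + 1/2) / 2 / (1 - t) - (1/4 + real (n mod 2) / 2) / t"
      by (simp only: n(2))
  qed
qed

section \<open>Monotonicity of the zeros\<close>

lemma diff_le_less_mono: "a \<le> b \<Longrightarrow> d < c \<Longrightarrow> a - c < b - (d :: real)"
  by linarith

text \<open>Unit charges in equilibrium between a charge d at 0 and a charge b at 1: a stronger
  charge at 1 pushes all of them towards 0. Two configurations are compared directly, so the zeros
  need not be differentiated in the parameter. Strictness comes from the d-term, hence b' = b is
  allowed.\<close>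

lemma equilibrium_mono:
  fixes T S :: "real set"
  assumes "finite T" "T \<subseteq> {0<..<1}" "finite S" "S \<subseteq> {0<..<1}" "card T = card S"
    and "d > 0" "b' \<ge> 0" "b' \<le> b"
    and T: "\<And>t. t \<in> T \<Longrightarrow> (\<Sum>s\<in>T - {t}. 1 / (t - s)) = b / (1 - t) - d / t"
    and S: "\<And>t. t \<in> S \<Longrightarrow> (\<Sum>s\<in>S - {t}. 1 / (t - s)) = b' / (1 - t) - d / t"
    and i: "i < card T"
  shows "sorted_list_of_set T ! i \<le> sorted_list_of_set S ! i"
proof (rule ccontr)
  define m where "m = card T"
  define t where "t = (!) (sorted_list_of_set T)"
  define s where "s = (!) (sorted_list_of_set S)"
  have bij_t: "bij_betw t {..<m} T"
    unfolding t_def m_def using assms(1) by (intro bij_betw_nth) auto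
  have bij_s: "bij_betw s {..<m} S"
    unfolding s_def m_def using assms(3,5) by (intro bij_betw_nth) auto
  have mono_t: "t j < t k" if "j < k" "k < m" for j k
    unfolding t_def using that assms(1)
    by (intro sorted_wrt_nth_less[OF strict_sorted_list_of_set]) (auto simp: m_def)
  have mono_s: "s j < s k" if "j < k" "k < m" for j k
    unfolding s_def using that assms(3,5)
    by (intro sorted_wrt_nth_less[OF strict_sorted_list_of_set]) (auto simp: m_def)
  have sum_t: "(\<Sum>k\<in>{..<m} - {j}. 1 / (t j - t k)) = b / (1 - t j) - d / t j" if "j < m" for j
  proof -
    have "bij_betw t ({..<m} - {j}) (T - {t j})"
      using bij_t that by (intro bij_betw_DiffI) (auto simp: bij_betw_def)
    from sum.reindex_bij_betw[OF this, of "\<lambda>x. 1 / (t j - x)"] T[of "t j"] bij_t that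
    show ?thesis by (auto simp: bij_betw_def)
  qed
  have sum_s: "(\<Sum>k\<in>{..<m} - {j}. 1 / (s j - s k)) = b' / (1 - s j) - d / s j" if "j < m" for j
  proof -
    have "bij_betw s ({..<m} - {j}) (S - {s j})"
      using bij_s that by (intro bij_betw_DiffI) (auto simp: bij_betw_def)
    from sum.reindex_bij_betw[OF this, of "\<lambda>x. 1 / (s j - x)"] S[of "s j"] bij_s that
    show ?thesis by (auto simp: bij_betw_def)
  qed
  assume "\<not> ?thesis"
  then have gt: "t i > s i" by (simp add: t_def s_def)
  \<comment> \<open>At the index where t - s is maximal, every term 1 / (t j - t k) is at most 1 / (s j - s k),
    while the external force has strictly increased.\<close>
  let ?D = "(\<lambda>k. t k - s k) ` {..<m}"
  have ne: "finite ?D" "?D \<noteq> {}" using i by (auto simp: m_def)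
  from Max_in[OF ne] obtain j where j: "j < m" "Max ?D = t j - s j" by (rule imageE) simp
  have max: "t k - s k \<le> t j - s j" if "k < m" for k
    unfolding j(2)[symmetric] using that by (intro Max_ge) auto
  have gtj: "t j > s j" using max[of i] gt i by (simp add: m_def)
  have tj: "t j \<in> {0<..<1}" "s j \<in> {0<..<1}"
    using bij_betwE[OF bij_t] bij_betwE[OF bij_s] j(1) assms(2,4) by blast+
  have "(\<Sum>k\<in>{..<m} - {j}. 1 / (t j - t k)) \<le> (\<Sum>k\<in>{..<m} - {j}. 1 / (s j - s k))"
  proof (rule sum_mono)
    fix k assume k: "k \<in> {..<m} - {j}"
    have "s j - s k \<le> t j - t k" using max[of k] k by simp
    \<comment> \<open>Both enumerations increase, so the two differences have the same sign and
      taking reciprocals reverses their order.\<close>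
    moreover have "(0 < s j - s k) \<or> (t j - t k < 0)"
      using k j(1) mono_s[of k j] mono_t[of j k] by (cases "k < j") auto
    ultimately show "1 / (t j - t k) \<le> 1 / (s j - s k)"
      unfolding inverse_eq_divide[symmetric]
      by (elim disjE) (rule le_imp_inverse_le le_imp_inverse_le_neg; assumption)+
  qed
  then have "b / (1 - t j) - d / t j \<le> b' / (1 - s j) - d / s j"
    using sum_t sum_s j(1) by simp
  also have "\<dots> < b / (1 - t j) - d / t j"
  proof (rule diff_le_less_mono)
    show "b' / (1 - s j) \<le> b / (1 - t j)"
      using tj gtj assms(7,8) by (intro frac_le) auto
    show "d / t j < d / s j"
      using tj gtj assms(6) by (intro divide_strict_left_mono) auto
  qed
  finally show False by simp
qed

section \<open>The Chebyshev cases\<close>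

text \<open>One step in s in the half-integer products below corresponds to two entries along a
  binomial row.\<close>

lemma binomial_two_steps:
  "real (j + 2) * real (j + 1) * real (m choose (j + 2)) = (real m - real j) * (real m - real j - 1) * real (m choose j)"
proof -
  have 1: "real (j + 1) * real (m choose (j + 1)) = (real m - real j) * real (m choose j)"
    using gbinomial_Suc_mult[of j "real m"] by (simp add: binomial_gbinomial)
  have 2: "real (j + 2) * real (m choose (j + 2)) = (real m - real j - 1) * real (m choose (j + 1))"
    using gbinomial_Suc_mult[of "Suc j" "real m"] by (simp add: binomial_gbinomial)
  have "real (j + 2) * real (j + 1) * real (m choose (j + 2)) = real (j + 1) * (real (j + 2) * real (m choose (j + 2)))"
    by (simp only: mult_ac)
  also have "\<dots> = (real m - real j - 1) * (real (j + 1) * real (m choose (j + 1)))"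
    unfolding 2 by (simp only: mult_ac)
  finally show ?thesis unfolding 1 by (simp only: mult_ac)
qed

text \<open>The case lam = 0. Both sides agree at s = 0 and have the same ratio (n - s)(n - s - 1/2)
  / ((s + 1)(s + 1/2)) from s to s + 1.\<close>

lemma gbinomial_half_integer_even:
  assumes "s \<le> n"
  shows "(real n - 1/2 gchoose s) * (real n - 1/2 gchoose (n - s)) = (real n - 1/2 gchoose n) * real ((2 * n) choose (2 * s))"
  using assms
proof (induction s)
  case (Suc s)
  define a where "a = real n - 1/2"
  let ?r = "real n" and ?k = "real s"
  obtain d where d: "n - s = Suc d" "n - Suc s = d" using Suc.prems by (metis Suc_diff_Suc Suc_le_eq)
  have rd: "real d = ?r - ?k - 1" using d Suc.prems by linarith
  have 1: "(?k + 1) * (a gchoose Suc s) = (a - ?k) * (a gchoose s)"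
    using gbinomial_Suc_mult[of s a] by (simp add: add.commute)
  have 2: "(?r - ?k) * (a gchoose (n - s)) = (?k + 1/2) * (a gchoose d)"
    using gbinomial_Suc_mult[of d a] rd by (simp add: d a_def algebra_simps)
  have b: "(2 * ?k + 2) * (2 * ?k + 1) * real ((2 * n) choose (2 * Suc s)) = (2 * ?r - 2 * ?k) * (2 * ?r - 2 * ?k - 1) * real ((2 * n) choose (2 * s))"
    using binomial_two_steps[of "2 * s" "2 * n"] by (simp add: algebra_simps)
  have IH: "(a gchoose s) * (a gchoose (n - s)) = (a gchoose n) * real ((2 * n) choose (2 * s))"
    using Suc by (simp add: a_def)
  have "((?k + 1) * (a gchoose Suc s)) * ((?k + 1/2) * (a gchoose d)) = (a - ?k) * (?r - ?k) * ((a gchoose s) * (a gchoose (n - s)))"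
    unfolding 1 2[symmetric] by simp
  also have "\<dots> = (a gchoose n) * ((2 * ?r - 2 * ?k) * (2 * ?r - 2 * ?k - 1) * real ((2 * n) choose (2 * s))) / 4"
  proof -
    have "(a - ?k) * (?r - ?k) = (2 * ?r - 2 * ?k) * (2 * ?r - 2 * ?k - 1) / 4"
      by (simp add: a_def field_simps)
    then show ?thesis unfolding IH by (simp only: mult_ac times_divide_eq_left times_divide_eq_right)
  qed
  also have "\<dots> = ((?k + 1) * (?k + 1/2)) * ((a gchoose n) * real ((2 * n) choose (2 * Suc s)))"
  proof -
    have "(?k + 1) * (?k + 1/2) = (2 * ?k + 2) * (2 * ?k + 1) / 4" by (simp add: field_simps)
    then show ?thesis unfolding b[symmetric] by (simp only: mult_ac times_divide_eq_left times_divide_eq_right)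
  qed
  finally have fin: "((?k + 1) * (?k + 1/2)) * ((a gchoose Suc s) * (a gchoose d)) = ((?k + 1) * (?k + 1/2)) * ((a gchoose n) * real ((2 * n) choose (2 * Suc s)))"
    by (simp add: mult_ac)
  have nz: "(?k + 1) * (?k + 1/2) \<noteq> 0" by (simp add: add_nonneg_eq_0_iff)
  show ?case using fin unfolding mult_left_cancel[OF nz] by (simp only: d a_def)
qed simp

text \<open>The case lam = 1, again by equal ratios. The divisor 2n + 2 is the binomial coefficient
  at s = 0.\<close>

lemma gbinomial_half_integer_odd:
  assumes "s \<le> n"
  shows "(real n + 1/2 gchoose s) * (real n + 1/2 gchoose (n - s))
    = (real n + 1/2 gchoose n) / (2 * real n + 2) * real ((2 * n + 2) choose (2 * s + 1))"
  using assms
proof (induction s)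
  case (Suc s)
  define a where "a = real n + 1/2"
  define C where "C = (a gchoose n) / (2 * real n + 2)"
  let ?r = "real n" and ?k = "real s"
  obtain d where d: "n - s = Suc d" "n - Suc s = d" using Suc.prems by (metis Suc_diff_Suc Suc_le_eq)
  have rd: "real d = ?r - ?k - 1" using d Suc.prems by linarith
  have 1: "(?k + 1) * (a gchoose Suc s) = (a - ?k) * (a gchoose s)"
    using gbinomial_Suc_mult[of s a] by (simp add: add.commute)
  have 2: "(?r - ?k) * (a gchoose (n - s)) = (?k + 3/2) * (a gchoose d)"
    using gbinomial_Suc_mult[of d a] rd by (simp add: d a_def algebra_simps)
  have b: "(2 * ?k + 3) * (2 * ?k + 2) * real ((2 * n + 2) choose (2 * Suc s + 1)) = (2 * ?r + 1 - 2 * ?k) * (2 * ?r - 2 * ?k) * real ((2 * n + 2) choose (2 * s + 1))"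
    using binomial_two_steps[of "2 * s + 1" "2 * n + 2"] by (simp add: algebra_simps del: binomial_Suc_Suc)
  have IH: "(a gchoose s) * (a gchoose (n - s)) = C * real ((2 * n + 2) choose (2 * s + 1))"
    using Suc by (simp add: a_def C_def)
  have "((?k + 1) * (a gchoose Suc s)) * ((?k + 3/2) * (a gchoose d)) = (a - ?k) * (?r - ?k) * ((a gchoose s) * (a gchoose (n - s)))"
    unfolding 1 2[symmetric] by simp
  also have "\<dots> = C * ((2 * ?r + 1 - 2 * ?k) * (2 * ?r - 2 * ?k) * real ((2 * n + 2) choose (2 * s + 1))) / 4"
  proof -
    have "(a - ?k) * (?r - ?k) = (2 * ?r + 1 - 2 * ?k) * (2 * ?r - 2 * ?k) / 4"
      by (simp add: a_def field_simps)
    then show ?thesis unfolding IH by (simp only: mult_ac times_divide_eq_left times_divide_eq_right)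
  qed
  also have "\<dots> = ((?k + 1) * (?k + 3/2)) * (C * real ((2 * n + 2) choose (2 * Suc s + 1)))"
  proof -
    have "(?k + 1) * (?k + 3/2) = (2 * ?k + 3) * (2 * ?k + 2) / 4" by (simp add: field_simps)
    then show ?thesis unfolding b[symmetric] by (simp only: mult_ac times_divide_eq_left times_divide_eq_right)
  qed
  finally have fin: "((?k + 1) * (?k + 3/2)) * ((a gchoose Suc s) * (a gchoose d)) = ((?k + 1) * (?k + 3/2)) * (C * real ((2 * n + 2) choose (2 * Suc s + 1)))"
    by (simp add: mult_ac)
  have nz: "(?k + 1) * (?k + 3/2) \<noteq> 0" by (simp add: add_nonneg_eq_0_iff)
  show ?case using fin unfolding mult_left_cancel[OF nz] by (simp only: d a_def C_def)
qed (simp add: field_simps)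

lemma binomial_even_part:
  fixes p q :: "'a::field_char_0"
  shows "(\<Sum>s\<le>n. of_nat ((2 * n) choose (2 * s)) * p ^ (2 * s) * q ^ (2 * (n - s))) = ((q + p) ^ (2 * n) + (q - p) ^ (2 * n)) / 2"
proof -
  have split: "(\<Sum>k\<le>2 * m. (1 + (-1) ^ k) * h k) = 2 * (\<Sum>s\<le>m. h (2 * s))" for m and h :: "nat \<Rightarrow> 'a"
    by (induction m) (simp_all add: distrib_left)
  have "(p + q) ^ (2 * n) + (- p + q) ^ (2 * n)
     = (\<Sum>k\<le>2 * n. (1 + (-1) ^ k) * (of_nat ((2 * n) choose k) * p ^ k * q ^ (2 * n - k)))"
    unfolding binomial_ring sum.distrib[symmetric] power_minus[of p]
    by (intro sum.cong) (simp_all add: algebra_simps)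
  also have "\<dots> = 2 * (\<Sum>s\<le>n. of_nat ((2 * n) choose (2 * s)) * p ^ (2 * s) * q ^ (2 * (n - s)))"
    unfolding split by (simp add: right_diff_distrib')
  finally show ?thesis by (simp add: add.commute)
qed

text \<open>In the even row 2n + 2 an odd exponent of p forces an odd exponent of q. One factor of
  each is pulled out; their product becomes u - 1/u, the denominator of Chebyshev U.\<close>

lemma binomial_odd_part:
  fixes p q :: "'a::field_char_0"
  shows "p * q * (\<Sum>s\<le>n. of_nat ((2 * n + 2) choose (2 * s + 1)) * p ^ (2 * s) * q ^ (2 * (n - s)))
    = ((q + p) ^ (2 * n + 2) - (q - p) ^ (2 * n + 2)) / 2"
proof -
  have split: "(\<Sum>k\<le>2 * m + 2. (1 - (-1) ^ k) * h k) = 2 * (\<Sum>s\<le>m. h (2 * s + 1))" for m and h :: "nat \<Rightarrow> 'a"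
  proof (induction m)
    case 0
    show ?case by (simp add: numeral_2_eq_2)
  next
    case (Suc m)
    have e: "2 * Suc m + 2 = Suc (Suc (2 * m + 2))" by simp
    show ?case unfolding e sum.atMost_Suc Suc.IH by (simp add: distrib_left)
  qed
  have "(p + q) ^ (2 * n + 2) - (- p + q) ^ (2 * n + 2)
     = (\<Sum>k\<le>2 * n + 2. (1 - (-1) ^ k) * (of_nat ((2 * n + 2) choose k) * p ^ k * q ^ (2 * n + 2 - k)))"
    unfolding binomial_ring sum_subtractf[symmetric] power_minus[of p]
    by (intro sum.cong) (simp_all add: algebra_simps)
  also have "\<dots> = 2 * (\<Sum>s\<le>n. p * q * (of_nat ((2 * n + 2) choose (2 * s + 1)) * p ^ (2 * s) * q ^ (2 * (n - s))))"
    unfolding split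
  proof (intro arg_cong[of _ _ "(*) 2"] sum.cong)
    fix s assume "s \<in> {..n}"
    then have "2 * n + 2 - (2 * s + 1) = Suc (2 * (n - s))" by auto
    then show "of_nat ((2 * n + 2) choose (2 * s + 1)) * p ^ (2 * s + 1) * q ^ (2 * n + 2 - (2 * s + 1)) =
      p * q * (of_nat ((2 * n + 2) choose (2 * s + 1)) * p ^ (2 * s) * q ^ (2 * (n - s)))"
      by (simp add: mult_ac)
  qed simp
  finally have "(q + p) ^ (2 * n + 2) - (q - p) ^ (2 * n + 2)
     = 2 * (p * q * (\<Sum>s\<le>n. of_nat ((2 * n + 2) choose (2 * s + 1)) * p ^ (2 * s) * q ^ (2 * (n - s))))"
    by (simp only: sum_distrib_left add.commute[of p q] uminus_add_conv_diff)
  then show ?thesis by simp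
qed

text \<open>A square root v of u makes z - 1 and z + 1 half the squares of p = v - 1/v and q = v +
  1/v. The binomial sums then collapse, because q + p = 2v and q - p = 2/v.\<close>

lemma joukowski_half:
  fixes u :: complex
  assumes "u \<noteq> 0"
  obtains v where "v \<noteq> 0" "v\<^sup>2 = u"
    "(u + inverse u) / 2 - 1 = (v - inverse v)\<^sup>2 / 2" "(u + inverse u) / 2 + 1 = (v + inverse v)\<^sup>2 / 2"
proof (rule that[of "csqrt u"])
  define v where "v = csqrt u"
  have v: "v \<noteq> 0" "v\<^sup>2 = u" using assms by (auto simp: v_def)
  then show "csqrt u \<noteq> 0" "(csqrt u)\<^sup>2 = u" by (auto simp: v_def)
  have "(u + inverse u) / 2 - 1 = (v - inverse v)\<^sup>2 / 2" "(u + inverse u) / 2 + 1 = (v + inverse v)\<^sup>2 / 2"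
    unfolding v(2)[symmetric] using v(1) by (simp_all add: field_simps power2_eq_square)
  then show "(u + inverse u) / 2 - 1 = (csqrt u - inverse (csqrt u))\<^sup>2 / 2"
    "(u + inverse u) / 2 + 1 = (csqrt u + inverse (csqrt u))\<^sup>2 / 2"
    by (simp_all add: v_def)
qed

lemma jacobi_sum_joukowski:
  fixes v z :: complex
  assumes "z - 1 = (v - inverse v)\<^sup>2 / 2" "z + 1 = (v + inverse v)\<^sup>2 / 2"
    and c: "\<And>s. s \<le> n \<Longrightarrow> (a gchoose s) * (a gchoose (n - s)) = C * real (c s)"
  shows "jacobi_sum n a z = of_real C / 2 ^ n *
    (\<Sum>s\<le>n. of_nat (c s) * (v - inverse v) ^ (2 * s) * (v + inverse v) ^ (2 * (n - s)))"
proof -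
  have "jacobi_sum n a z = (\<Sum>s\<le>n. of_real C / 2 ^ n * (of_nat (c s) * (v - inverse v) ^ (2 * s) * (v + inverse v) ^ (2 * (n - s))))"
    unfolding jacobi_sum_def
  proof (rule sum.cong)
    fix s assume s: "s \<in> {..n}"
    then have "(2::complex) ^ n = 2 ^ s * 2 ^ (n - s)" by (simp add: power_add[symmetric])
    then show "of_real ((a gchoose s) * (a gchoose (n - s))) * (z - 1) ^ s * (z + 1) ^ (n - s)
      = of_real C / 2 ^ n * (of_nat (c s) * (v - inverse v) ^ (2 * s) * (v + inverse v) ^ (2 * (n - s)))"
      using s c unfolding assms(1,2) by (simp add: power_divide power_mult del: of_real_mult) simp
  qed simp
  then show ?thesis by (simp add: sum_distrib_left)
qed

lemma jacobi_sum_chebyshev_T: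
  "\<exists>K. \<forall>u. u \<noteq> 0 \<longrightarrow> jacobi_sum n (real n - 1/2) ((u + inverse u) / 2) = K * (u ^ n + inverse (u ^ n) :: complex)"
proof (intro exI allI impI)
  fix u :: complex assume "u \<noteq> 0"
  then obtain v where v: "v \<noteq> 0" "v\<^sup>2 = u"
    "(u + inverse u) / 2 - 1 = (v - inverse v)\<^sup>2 / 2" "(u + inverse u) / 2 + 1 = (v + inverse v)\<^sup>2 / 2"
    by (rule joukowski_half)
  have "(v + inverse v + (v - inverse v)) ^ (2 * n) + (v + inverse v - (v - inverse v)) ^ (2 * n) = 2 ^ (2 * n) * (u ^ n + inverse (u ^ n))"
  proof -
    have *: "v + inverse v + (v - inverse v) = 2 * v" "v + inverse v - (v - inverse v) = 2 * inverse v" by simp_all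
    have "(2 * v) ^ (2 * n) = 2 ^ (2 * n) * u ^ n" "(2 * inverse v) ^ (2 * n) = 2 ^ (2 * n) * inverse (u ^ n)"
      unfolding v(2)[symmetric] by (simp_all only: power_mult_distrib power_mult power_inverse)
    then show ?thesis unfolding * by (simp only: distrib_left)
  qed
  note sum_eq = binomial_even_part[of n "v - inverse v" "v + inverse v", unfolded this]
  have J: "jacobi_sum n (real n - 1/2) ((u + inverse u) / 2) = of_real (real n - 1/2 gchoose n) / 2 ^ n *
    (\<Sum>s\<le>n. of_nat ((2 * n) choose (2 * s)) * (v - inverse v) ^ (2 * s) * (v + inverse v) ^ (2 * (n - s)))"
    by (rule jacobi_sum_joukowski[OF v(3,4) gbinomial_half_integer_even])
  \<comment> \<open>The witness left open at the start is read off here; it depends on n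
    alone.\<close>
  show "jacobi_sum n (real n - 1/2) ((u + inverse u) / 2)
    = of_real (real n - 1/2 gchoose n) / 2 ^ n * (2 ^ (2 * n) / 2) * (u ^ n + inverse (u ^ n))"
    unfolding J sum_eq
    by (simp only: mult.assoc times_divide_eq_left)
qed

text \<open>The factor u - 1/u stays on the left so that u = 1 and u = -1 are covered.\<close>

lemma jacobi_sum_chebyshev_U:
  "\<exists>K. \<forall>u. u \<noteq> 0 \<longrightarrow> (u - inverse u) * jacobi_sum n (real n + 1/2) ((u + inverse u) / 2)
     = K * (u ^ Suc n - inverse (u ^ Suc n) :: complex)"
proof (intro exI allI impI)
  fix u :: complex assume "u \<noteq> 0"
  then obtain v where v: "v \<noteq> 0" "v\<^sup>2 = u"
    "(u + inverse u) / 2 - 1 = (v - inverse v)\<^sup>2 / 2" "(u + inverse u) / 2 + 1 = (v + inverse v)\<^sup>2 / 2"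
    by (rule joukowski_half)
  let ?p = "v - inverse v" and ?q = "v + inverse v"
  have pq: "?p * ?q = u - inverse u"
    unfolding v(2)[symmetric] using v(1) by (simp add: field_simps power2_eq_square)
  have "(?q + ?p) ^ (2 * n + 2) - (?q - ?p) ^ (2 * n + 2) = 2 ^ (2 * n + 2) * (u ^ Suc n - inverse (u ^ Suc n))"
  proof -
    have *: "?q + ?p = 2 * v" "?q - ?p = 2 * inverse v" "2 * n + 2 = 2 * Suc n" by simp_all
    have "(2 * v) ^ (2 * Suc n) = 2 ^ (2 * Suc n) * u ^ Suc n"
      "(2 * inverse v) ^ (2 * Suc n) = 2 ^ (2 * Suc n) * inverse (u ^ Suc n)"
      unfolding v(2)[symmetric] by (simp_all only: power_mult_distrib power_mult power_inverse)
    then show ?thesis unfolding * by (simp only: right_diff_distrib)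
  qed
  then have sum_eq: "(u - inverse u) * (\<Sum>s\<le>n. of_nat ((2 * n + 2) choose (2 * s + 1)) * ?p ^ (2 * s) * ?q ^ (2 * (n - s)))
     = 2 ^ (2 * n + 2) / 2 * (u ^ Suc n - inverse (u ^ Suc n))"
    using binomial_odd_part[of ?p ?q n] unfolding pq by (simp del: power_Suc)
  have J: "jacobi_sum n (real n + 1/2) ((u + inverse u) / 2) = of_real ((real n + 1/2 gchoose n) / (2 * real n + 2)) / 2 ^ n *
    (\<Sum>s\<le>n. of_nat ((2 * n + 2) choose (2 * s + 1)) * ?p ^ (2 * s) * ?q ^ (2 * (n - s)))"
    by (rule jacobi_sum_joukowski[OF v(3,4) gbinomial_half_integer_odd])
  show "(u - inverse u) * jacobi_sum n (real n + 1/2) ((u + inverse u) / 2)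
     = of_real ((real n + 1/2 gchoose n) / (2 * real n + 2)) / 2 ^ n * (2 ^ (2 * n + 2) / 2) * (u ^ Suc n - inverse (u ^ Suc n))"
    unfolding J mult.left_commute[of "u - inverse u"] sum_eq by (simp only: mult.assoc)
qed

section \<open>Chebyshev minima on the ellipse\<close>

lemma inverse_polar: "inverse (complex_of_real r * cis t) = complex_of_real (1 / r) * cis (- t)"
  by (simp add: inverse_mult_distrib inverse_eq_divide[of "complex_of_real r"])

text \<open>Meant for rho^n and n t in place of r and t: powers of rho cis t keep the polar form, so
  one formula covers every degree.\<close>

lemma cmod_add_inverse_sq:
  assumes "r > 0"
  shows "(cmod (complex_of_real r * cis t + inverse (complex_of_real r * cis t)))\<^sup>2 = (r - 1 / r)\<^sup>2 + 4 * (cos t)\<^sup>2"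
proof -
  have "complex_of_real r * cis t + inverse (complex_of_real r * cis t) = Complex ((r + 1 / r) * cos t) ((r - 1 / r) * sin t)"
    unfolding inverse_polar by (simp add: complex_eq_iff algebra_simps del: of_real_divide)
  then show ?thesis
    using assms unfolding cmod_power2 by (simp add: power_mult_distrib sin_squared_eq) (simp add: field_simps power2_eq_square)
qed

lemma cmod_diff_inverse_sq:
  assumes "r > 0"
  shows "(cmod (complex_of_real r * cis t - inverse (complex_of_real r * cis t)))\<^sup>2 = (r + 1 / r)\<^sup>2 - 4 * (cos t)\<^sup>2"
proof -
  have "complex_of_real r * cis t - inverse (complex_of_real r * cis t) = Complex ((r - 1 / r) * cos t) ((r + 1 / r) * sin t)"
    unfolding inverse_polar by (simp add: complex_eq_iff algebra_simps del: of_real_divide)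
  then show ?thesis
    using assms unfolding cmod_power2 by (simp add: power_mult_distrib sin_squared_eq) (simp add: field_simps power2_eq_square)
qed

text \<open>The parities need each other: the addition formulas lead from odd cosine to even sine
  and back, each step costing one |cos t|. At cos t = 0 the bound says that the left side
  vanishes.\<close>

lemma abs_cos_mult_le:
  "(odd N \<longrightarrow> \<bar>cos (real N * t)\<bar> \<le> real N * \<bar>cos t\<bar>) \<and> (even N \<longrightarrow> \<bar>sin (real N * t)\<bar> \<le> real N * \<bar>cos t\<bar>)"
proof (induction N)
  case (Suc N)
  have e: "real (Suc N) * t = real N * t + t" by (simp add: distrib_right)
  have a: "\<bar>cos (real N * t) * cos t\<bar> \<le> \<bar>cos t\<bar>" "\<bar>sin (real N * t) * cos t\<bar> \<le> \<bar>cos t\<bar>"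
    "\<bar>sin (real N * t) * sin t\<bar> \<le> \<bar>sin (real N * t)\<bar>" "\<bar>cos (real N * t) * sin t\<bar> \<le> \<bar>cos (real N * t)\<bar>"
    by (auto simp: abs_mult intro: mult_left_le mult_left_le_one_le)
  show ?case
  proof (cases "even N")
    case True
    have "\<bar>cos (real N * t) * cos t - sin (real N * t) * sin t\<bar> \<le> \<bar>cos t\<bar> + real N * \<bar>cos t\<bar>"
      using Suc True by (intro order.trans[OF abs_triangle_ineq4] add_mono a(1) order.trans[OF a(3)]) simp
    then show ?thesis using True unfolding e cos_add by (simp add: distrib_right)
  next
    case False
    have "\<bar>sin (real N * t) * cos t + cos (real N * t) * sin t\<bar> \<le> \<bar>cos t\<bar> + real N * \<bar>cos t\<bar>"
      using Suc False by (intro order.trans[OF abs_triangle_ineq] add_mono a(2) order.trans[OF a(4)]) simp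
    then show ?thesis using False unfolding e sin_add by (simp add: distrib_right)
  qed
qed simp

lemma power_add_inverse_growth:
  fixes rho :: real
  assumes "rho \<ge> 1" "rho\<^sup>2 + 1 / rho\<^sup>2 \<ge> 4"
  shows "real (2 * k + 1) * (rho + 1 / rho) \<le> rho ^ (2 * k + 1) + 1 / rho ^ (2 * k + 1)"
proof -
  define P where "P j = rho ^ (2 * j + 1) + 1 / rho ^ (2 * j + 1)" for j
  have r0: "rho > 0" using assms by simp
  have rec: "(rho\<^sup>2 + 1 / rho\<^sup>2) * P (Suc j) = P (Suc (Suc j)) + P j" for j
    using r0 by (simp add: P_def field_simps power2_eq_square power_add)
  have pos: "P j > 0" for j using r0 by (auto simp: P_def intro: add_pos_pos)
  \<comment> \<open>This is the cubic defining rho_2^*, with equality at rho_2^* itself.\<close>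
  have base: "P (Suc 0) \<ge> 3 * P 0"
  proof -
    have "P (Suc 0) = (rho\<^sup>2 + 1 / rho\<^sup>2 - 1) * P 0"
      using r0 by (simp add: P_def field_simps power2_eq_square power3_eq_cube)
    then show ?thesis using assms(2) pos[of 0] by simp
  qed
  \<comment> \<open>The factor 3 is 4 - 1: P (j + 2) is at least 4 P (j + 1) - P j, and P j is at
    most P (j + 1).\<close>
  have step: "P (Suc j) \<ge> 3 * P j" for j
  proof (induction j)
    case (Suc j)
    have "4 * P (Suc j) \<le> (rho\<^sup>2 + 1 / rho\<^sup>2) * P (Suc j)"
      using assms(2) pos[of "Suc j"] by simp
    then show ?case using Suc pos[of j] unfolding rec by simp
  qed (use base in simp)
  have "real (2 * k + 1) * P 0 \<le> P k"
  proof (induction k)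
    case (Suc k)
    have "P 0 \<le> real (2 * k + 1) * P 0" using pos[of 0] by simp
    moreover have "real (2 * Suc k + 1) * P 0 = real (2 * k + 1) * P 0 + 2 * P 0" by (simp add: algebra_simps)
    ultimately show ?case using Suc step[of k] by linarith
  qed simp
  then show ?thesis by (simp add: P_def)
qed

definition ellipse_point :: "real \<Rightarrow> real \<Rightarrow> complex" where
  "ellipse_point rho t = (complex_of_real rho * cis t + inverse (complex_of_real rho * cis t)) / 2"

text \<open>Only the term 4 cos(nt)^2 of |u^n + u^-n|^2 depends on t, and for odd n it vanishes
  wherever cos t does.\<close>

lemma chebyshev_T_minimum:
  assumes "rho > 0" "odd n" "cos t0 = 0"
  shows "cmod (jacobi_sum n (real n - 1/2) (ellipse_point rho t0)) \<le> cmod (jacobi_sum n (real n - 1/2) (ellipse_point rho t))"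
proof -
  obtain K where K: "\<And>u::complex. u \<noteq> 0 \<Longrightarrow> jacobi_sum n (real n - 1/2) ((u + inverse u) / 2) = K * (u ^ n + inverse (u ^ n))"
    using jacobi_sum_chebyshev_T[of n] by blast
  have pow: "(complex_of_real rho * cis t) ^ n = complex_of_real (rho ^ n) * cis (real n * t)" for t
    by (simp only: power_mult_distrib Complex.DeMoivre of_real_power)
  have eq: "(cmod (jacobi_sum n (real n - 1/2) (ellipse_point rho t)))\<^sup>2
     = (cmod K)\<^sup>2 * ((rho ^ n - 1 / rho ^ n)\<^sup>2 + 4 * (cos (real n * t))\<^sup>2)" for t
    unfolding ellipse_point_def using assms(1)
    by (subst K) (simp_all only: norm_mult power_mult_distrib[of "cmod K"] pow cmod_add_inverse_sq[OF zero_less_power], simp)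
  have "cos (real n * t0) = 0" using abs_cos_mult_le[of n t0] assms by simp
  then have "(cmod (jacobi_sum n (real n - 1/2) (ellipse_point rho t0)))\<^sup>2 \<le> (cmod (jacobi_sum n (real n - 1/2) (ellipse_point rho t)))\<^sup>2"
    unfolding eq by (intro mult_left_mono) auto
  then show ?thesis by (rule power2_le_imp_le) simp
qed

text \<open>The squared modulus is k (Q - 4 cos(Nt)^2) / (P - 4 cos(t)^2), whose denominator is
  largest at cos t = 0. For even N the numerator is smallest there; for odd N it is largest there,
  and the two effects must be weighed.\<close>

lemma chebyshev_U_minimum:
  assumes rho: "rho \<ge> 1" "rho\<^sup>2 + 1 / rho\<^sup>2 \<ge> 4" and "cos t0 = 0"
  shows "cmod (jacobi_sum n (real n + 1/2) (ellipse_point rho t0)) \<le> cmod (jacobi_sum n (real n + 1/2) (ellipse_point rho t))"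
proof -
  obtain K where K: "\<And>u::complex. u \<noteq> 0 \<Longrightarrow> (u - inverse u) * jacobi_sum n (real n + 1/2) ((u + inverse u) / 2) = K * (u ^ Suc n - inverse (u ^ Suc n))"
    using jacobi_sum_chebyshev_U[of n] by blast
  define J where "J t = (cmod (jacobi_sum n (real n + 1/2) (ellipse_point rho t)))\<^sup>2" for t
  define N where "N = Suc n"
  define P where "P = (rho + 1 / rho)\<^sup>2"
  define Q where "Q = (rho ^ N + 1 / rho ^ N)\<^sup>2"
  define k where "k = (cmod K)\<^sup>2"
  have r0: "rho > 0" using rho by simp
  have pow: "(complex_of_real rho * cis t) ^ N = complex_of_real (rho ^ N) * cis (real N * t)" for t
    by (simp only: power_mult_distrib Complex.DeMoivre of_real_power)
  have eq: "(P - 4 * (cos t)\<^sup>2) * J t = k * (Q - 4 * (cos (real N * t))\<^sup>2)" for t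
  proof -
    let ?u = "complex_of_real rho * cis t"
    have "?u \<noteq> 0" using r0 by simp
    from arg_cong[OF K[OF this], of "\<lambda>z. (cmod z)\<^sup>2"]
    have "(cmod (?u - inverse ?u))\<^sup>2 * J t = k * (cmod (?u ^ N - inverse (?u ^ N)))\<^sup>2"
      by (simp only: J_def k_def N_def ellipse_point_def norm_mult power_mult_distrib[of "cmod _"])
    then show ?thesis unfolding pow using r0
      by (simp only: cmod_diff_inverse_sq[OF r0] cmod_diff_inverse_sq[OF zero_less_power[OF r0]] P_def Q_def)
  qed
  have P6: "P \<ge> 6"
    using rho r0 by (simp add: P_def power2_sum power_one_over)
  have Q4: "Q \<ge> 4"
  proof -
    have "Q = (rho ^ N - 1 / rho ^ N)\<^sup>2 + 4" using r0 by (simp add: Q_def power2_sum power2_diff)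
    then show ?thesis by simp
  qed
  have c: "(cos x)\<^sup>2 \<ge> 0" "(cos x)\<^sup>2 \<le> 1" for x :: real by (simp_all add: abs_square_le_1)
  have pos: "P - 4 * (cos t)\<^sup>2 > 0" using P6 c[of t] by linarith
  have k0: "k \<ge> 0" by (simp add: k_def)
  have ineq: "(Q - 4 * (cos (real N * t0))\<^sup>2) * (P - 4 * (cos t)\<^sup>2) \<le> P * (Q - 4 * (cos (real N * t))\<^sup>2)"
  proof (cases "even N")
    case True
    then have "sin (real N * t0) = 0" using abs_cos_mult_le[of N t0] assms by simp
    then have 1: "(cos (real N * t0))\<^sup>2 = 1" by (simp add: cos_squared_eq)
    have "(Q - 4) * (P - 4 * (cos t)\<^sup>2) \<le> (Q - 4) * P"
      using Q4 by (intro mult_left_mono) auto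
    also have "\<dots> \<le> (Q - 4 * (cos (real N * t))\<^sup>2) * P"
      using P6 c[of "real N * t"] by (intro mult_right_mono) auto
    finally show ?thesis unfolding 1 by (simp add: mult.commute)
  next
    case False
    then have 0: "cos (real N * t0) = 0" using abs_cos_mult_le[of N t0] assms by simp
    obtain j where j: "N = 2 * j + 1" using False by (auto elim: oddE)
    \<comment> \<open>What remains is P cos(Nt)^2 <= Q cos(t)^2. By |cos Nt| <= N |cos t| it
      suffices that N^2 P <= Q.\<close>
    have "real N * (rho + 1 / rho) \<le> rho ^ N + 1 / rho ^ N"
      using power_add_inverse_growth[OF rho, of j] unfolding j .
    then have "(real N * (rho + 1 / rho))\<^sup>2 \<le> Q"
      unfolding Q_def using r0 by (intro power_mono) auto
    then have Q: "(real N)\<^sup>2 * P \<le> Q" by (simp add: P_def power_mult_distrib)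
    have "\<bar>cos (real N * t)\<bar>\<^sup>2 \<le> (real N * \<bar>cos t\<bar>)\<^sup>2"
      using abs_cos_mult_le[of N t] False by (intro power_mono) auto
    then have "P * (cos (real N * t))\<^sup>2 \<le> P * ((real N)\<^sup>2 * (cos t)\<^sup>2)"
      using P6 by (intro mult_left_mono) (auto simp: power_mult_distrib)
    also have "\<dots> = ((real N)\<^sup>2 * P) * (cos t)\<^sup>2" by simp
    also have "\<dots> \<le> Q * (cos t)\<^sup>2" using Q by (intro mult_right_mono) auto
    finally show ?thesis unfolding 0 by (simp add: algebra_simps)
  qed
  have "(P * (P - 4 * (cos t)\<^sup>2)) * J t0 = k * ((Q - 4 * (cos (real N * t0))\<^sup>2) * (P - 4 * (cos t)\<^sup>2))"
    using eq[of t0] assms(3) by (simp add: mult_ac)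
  also have "\<dots> \<le> k * (P * (Q - 4 * (cos (real N * t))\<^sup>2))"
    using ineq k0 by (rule mult_left_mono)
  also have "\<dots> = P * ((P - 4 * (cos t)\<^sup>2) * J t)" unfolding eq by simp
  finally have "(P * (P - 4 * (cos t)\<^sup>2)) * J t0 \<le> (P * (P - 4 * (cos t)\<^sup>2)) * J t" by (simp only: mult.assoc)
  then have "J t0 \<le> J t" using pos P6 by (simp add: mult_le_cancel_left_pos)
  then show ?thesis unfolding J_def by (rule power2_le_imp_le) simp
qed

section \<open>The modulus on the ellipse\<close>

definition quad_factor :: "real \<Rightarrow> real \<Rightarrow> real \<Rightarrow> real" where
  "quad_factor A y t = (y\<^sup>2 + 2 * (1 - 2 * t) * A * y + (1 - 2 * t)\<^sup>2 + A\<^sup>2 - 1) / 4"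

lemma cmod_ellipse_point:
  fixes rho t :: real
  assumes "rho > 0"
  defines "A \<equiv> (rho\<^sup>2 + 1 / rho\<^sup>2) / 2" and "z \<equiv> ellipse_point rho t"
  shows "(cmod z)\<^sup>2 = (A + cos (2 * t)) / 2"
    and "(cmod (z\<^sup>2 - complex_of_real x))\<^sup>2 = quad_factor A (cos (2 * t)) x"
proof -
  define a where "a = (rho + 1 / rho) / 2"
  define b where "b = (rho - 1 / rho) / 2"
  define C where "C = (cos t)\<^sup>2"
  have z: "z = Complex (a * cos t) (b * sin t)"
    unfolding z_def ellipse_point_def
    unfolding inverse_polar by (simp add: a_def b_def complex_eq_iff algebra_simps del: of_real_divide)
  have a2: "a\<^sup>2 = (A + 1) / 2" and b2: "b\<^sup>2 = (A - 1) / 2"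
    using assms(1) by (simp_all add: a_def b_def A_def power2_eq_square field_simps)
  have s: "(sin t)\<^sup>2 = 1 - C" by (simp add: C_def sin_squared_eq)
  have y: "cos (2 * t) = 2 * C - 1" by (simp add: C_def cos_double_cos)
  have re: "(a * cos t)\<^sup>2 = (A + 1) / 2 * C" and im: "(b * sin t)\<^sup>2 = (A - 1) / 2 * (1 - C)"
    by (simp_all add: power_mult_distrib a2 b2 s C_def[symmetric])
  show "(cmod z)\<^sup>2 = (A + cos (2 * t)) / 2"
    unfolding z cmod_power2 y complex.sel re im by (simp add: field_simps)
  have "(cmod (z\<^sup>2 - complex_of_real x))\<^sup>2 = ((a * cos t)\<^sup>2 - (b * sin t)\<^sup>2 - x)\<^sup>2 + 4 * (a * cos t)\<^sup>2 * (b * sin t)\<^sup>2"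
    unfolding z cmod_power2 by (simp add: power2_eq_square)
  also have "\<dots> = quad_factor A (cos (2 * t)) x"
    unfolding re im y quad_factor_def by (simp add: power2_eq_square field_simps)
  finally show "(cmod (z\<^sup>2 - complex_of_real x))\<^sup>2 = quad_factor A (cos (2 * t)) x" .
qed

text \<open>The difference of the two sides factors as (y + 1)(c - d)/16 times a bracket that is
  affine in y with slope 2A - c - d > 0. Hence only its value at y = -1 has to be checked.\<close>

lemma quad_factor_mono:
  assumes A: "A \<ge> 2" and y: "-1 \<le> y" and t: "0 < t" "t < 1" and s: "0 < s" "s < 1" and ts: "t \<le> s"
  shows "quad_factor A y s * quad_factor A (-1) t \<le> quad_factor A y t * quad_factor A (-1) s"
proof -
  define c where "c = 1 - 2 * t"
  define d where "d = 1 - 2 * s"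
  have cd: "d \<le> c" "\<bar>c\<bar> < 1" "\<bar>d\<bar> < 1" "-1 < c" "-1 < d" using t s ts by (auto simp: c_def d_def)
  have "\<bar>c * d\<bar> \<le> 1" unfolding abs_mult using cd by (intro mult_le_one) auto
  moreover have "A\<^sup>2 \<ge> 4" using power_mono[OF A, of 2] by simp
  ultimately have "A * (A\<^sup>2 - c * d) \<ge> A * 3" using A by (intro mult_left_mono) auto
  \<comment> \<open>The bracket at y = -1: by A^2 - cd >= 3 and c + d > -2 it exceeds 6A - 4A - 4 =
    2A - 4 >= 0.\<close>
  then have 1: "2 * A * (A\<^sup>2 - c * d) - 2 * (2 * A - c - d) \<ge> 0"
  proof -
    have "2 * x - 2 * (2 * A - c - d) \<ge> 0" if "A * 3 \<le> x" for x
      using that A cd(4,5) by argo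
    then show ?thesis using \<open>A * 3 \<le> A * (A\<^sup>2 - c * d)\<close> unfolding mult.assoc by blast
  qed
  have "(y + 1) * (2 * A - c - d) \<ge> 0" using y A cd by (intro mult_nonneg_nonneg) auto
  with 1 have "2 * A * (A\<^sup>2 - c * d) + (y - 1) * (2 * A - c - d) \<ge> 0" by (simp add: algebra_simps)
  then have "(y + 1) * ((c - d) * (2 * A * (A\<^sup>2 - c * d) + (y - 1) * (2 * A - c - d))) \<ge> 0"
    using y cd by (intro mult_nonneg_nonneg) auto
  moreover have "16 * (quad_factor A y t * quad_factor A (-1) s - quad_factor A y s * quad_factor A (-1) t)
     = (y + 1) * ((c - d) * (2 * A * (A\<^sup>2 - c * d) + (y - 1) * (2 * A - c - d)))"
  proof -
    have *: "16 * (p / 4 * (q / 4) - r / 4 * (s / 4)) = p * q - r * s" for p q r s :: real by simp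
    show ?thesis
      unfolding quad_factor_def c_def[symmetric] d_def[symmetric] * by (simp add: power2_eq_square algebra_simps)
  qed
  ultimately have "0 \<le> 16 * (quad_factor A y t * quad_factor A (-1) s - quad_factor A y s * quad_factor A (-1) t)"
    by (simp only:)
  then show ?thesis by simp
qed

lemma quad_factor_pos:
  assumes A: "A \<ge> 2" and t: "0 < t" "t < 1"
  shows "quad_factor A (-1) t > 0"
proof -
  have "quad_factor A (-1) t = (A - (1 - 2 * t))\<^sup>2 / 4"
    by (simp add: quad_factor_def power2_eq_square algebra_simps)
  also have "\<dots> > 0" using assms by simp
  finally show ?thesis .
qed

lemma quad_factor_nonneg: "rho > 0 \<Longrightarrow> quad_factor ((rho\<^sup>2 + 1 / rho\<^sup>2) / 2) (cos (2 * t)) x \<ge> 0"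
  by (subst cmod_ellipse_point(2)[symmetric]) auto

section \<open>Comparison of two parameters and the conclusion\<close>

lemma gegenbauerC_eq:
  "gegenbauerC n lam z = complex_of_real (Gamma (lam + 1/2) * Gamma (real n + 2 * lam) / (Gamma (2 * lam) * Gamma (real n + lam + 1/2)) / 2 ^ n)
    * jacobi_sum n (real n + lam - 1/2) z"
proof -
  have "jacobiP n (lam - 1/2) (lam - 1/2) z = jacobi_sum n (real n + lam - 1/2) z / 2 ^ n"
    unfolding jacobiP_def jacobi_sum_def sum_divide_distrib
  proof (rule sum.cong)
    fix s assume "s \<in> {..n}"
    then have e: "(2::complex) ^ n = 2 ^ s * 2 ^ (n - s)" by (simp add: power_add[symmetric])
    have a: "real n + (lam - 1/2) = real n + lam - 1/2" by simp
    show "complex_of_real (((real n + (lam - 1/2)) gchoose (n - s)) * ((real n + (lam - 1/2)) gchoose s)) * ((z - 1) / 2) ^ s * ((z + 1) / 2) ^ (n - s)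
      = complex_of_real ((real n + lam - 1/2 gchoose s) * (real n + lam - 1/2 gchoose (n - s))) * (z - 1) ^ s * (z + 1) ^ (n - s) / 2 ^ n"
      unfolding a e by (simp add: power_divide)
  qed simp
  then show ?thesis by (simp add: gegenbauerC_def)
qed

text \<open>The quotient of the squared moduli for lam and mu is a constant times a product of pair
  quotients, each smallest at t0. In cross-multiplied form only the value for mu at t0 has to be
  positive.\<close>

lemma jacobi_sum_ellipse_ratio_mono:
  assumes rho: "rho > 0" "rho\<^sup>2 + 1 / rho\<^sup>2 \<ge> 4" and mu: "0 \<le> mu" "mu \<le> lam" and t0: "cos t0 = 0"
    and le: "cmod (jacobi_sum n (real n + mu - 1/2) (ellipse_point rho t0)) \<le> cmod (jacobi_sum n (real n + mu - 1/2) (ellipse_point rho t))"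
  shows "cmod (jacobi_sum n (real n + lam - 1/2) (ellipse_point rho t0)) \<le> cmod (jacobi_sum n (real n + lam - 1/2) (ellipse_point rho t))"
proof -
  define m where "m = n div 2"
  define A where "A = (rho\<^sup>2 + 1 / rho\<^sup>2) / 2"
  have A: "A \<ge> 2" using rho by (simp add: A_def)
  define F where "F l t = (cmod (jacobi_sum n (real n + l - 1/2) (ellipse_point rho t)))\<^sup>2" for l t
  have gt: "lam > -1/2" "mu > -1/2" using mu by auto
  obtain T K where T: "finite T" "T \<subseteq> {0<..<1}" "card T = m" "K \<noteq> 0"
    "\<And>z::complex. jacobi_sum n (real n + lam - 1/2) z = of_real K * z ^ (n mod 2) * (\<Prod>t\<in>T. z\<^sup>2 - of_real t)"
    "\<And>t. t \<in> T \<Longrightarrow> (\<Sum>s\<in>T - {t}. 1 / (t - s)) = (lam + 1/2) / 2 / (1 - t) - (1/4 + real (n mod 2) / 2) / t"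
    unfolding m_def by (rule gegenbauer_factorization[where n = n, OF gt(1)]) blast
  obtain S L where S: "finite S" "S \<subseteq> {0<..<1}" "card S = m" "L \<noteq> 0"
    "\<And>z::complex. jacobi_sum n (real n + mu - 1/2) z = of_real L * z ^ (n mod 2) * (\<Prod>t\<in>S. z\<^sup>2 - of_real t)"
    "\<And>t. t \<in> S \<Longrightarrow> (\<Sum>s\<in>S - {t}. 1 / (t - s)) = (mu + 1/2) / 2 / (1 - t) - (1/4 + real (n mod 2) / 2) / t"
    unfolding m_def by (rule gegenbauer_factorization[where n = n, OF gt(2)]) blast
  define x where "x = (!) (sorted_list_of_set T)"
  define y where "y = (!) (sorted_list_of_set S)"
  have bij: "bij_betw x {..<m} T" "bij_betw y {..<m} S"
    unfolding x_def y_def using T S by (auto intro!: bij_betw_nth)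
  have rng: "0 < x i" "x i < 1" "0 < y i" "y i < 1" if "i < m" for i
    using that bij T(2) S(2) by (auto simp: bij_betw_def)
  \<comment> \<open>The charge at 1 grows with the parameter, while the charge at 0 depends only on
    the parity of n.\<close>
  have xy: "x i \<le> y i" if "i < m" for i
    unfolding x_def y_def
    by (rule equilibrium_mono[OF T(1,2) S(1,2) _ _ _ _ T(6) S(6)]) (use that mu T(3) S(3) in auto)
  \<comment> \<open>The contribution of a zero at the origin; it is the same for both
    parameters.\<close>
  define w where "w t = ((A + cos (2 * t)) / 2) ^ (n mod 2)" for t
  define q where "q t s = quad_factor A (cos (2 * t)) s" for t s
  have prod_eq: "(cmod (complex_of_real k * ellipse_point rho t ^ (n mod 2) * (\<Prod>s\<in>U. (ellipse_point rho t)\<^sup>2 - complex_of_real s)))\<^sup>2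
      = k\<^sup>2 * w t * (\<Prod>s\<in>U. q t s)" for k t U
  proof -
    have "(cmod (ellipse_point rho t ^ (n mod 2)))\<^sup>2 = w t"
      unfolding norm_power power_mult[symmetric] mult.commute[of _ 2]
      unfolding power_mult cmod_ellipse_point[OF rho(1)] w_def A_def ..
    moreover have "(cmod (\<Prod>s\<in>U. (ellipse_point rho t)\<^sup>2 - complex_of_real s))\<^sup>2 = (\<Prod>s\<in>U. q t s)"
      unfolding prod_norm[symmetric] prod_power_distrib cmod_ellipse_point[OF rho(1)] q_def A_def ..
    ultimately show ?thesis unfolding norm_mult power_mult_distrib by simp
  qed
  have Flam: "F lam t = K\<^sup>2 * w t * (\<Prod>i<m. q t (x i))" for t
    unfolding F_def T(5) prod_eq prod.reindex_bij_betw[OF bij(1)] ..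
  have Fmu: "F mu t = L\<^sup>2 * w t * (\<Prod>i<m. q t (y i))" for t
    unfolding F_def S(5) prod_eq prod.reindex_bij_betw[OF bij(2)] ..
  have c0: "cos (2 * t0) = -1" using t0 by (simp add: cos_double_cos)
  have w_pos: "w t > 0" for t
  proof -
    have "A + cos (2 * t) > 0" using A cos_ge_minus_one[of "2 * t"] by linarith
    then show ?thesis unfolding w_def by simp
  qed
  have q_nonneg: "q t s \<ge> 0" for t s
    unfolding q_def A_def by (rule quad_factor_nonneg[OF rho(1)])
  have q0: "q t0 s > 0" if "0 < s" "s < 1" for s
    unfolding q_def c0 by (rule quad_factor_pos[OF A that])
  have "(\<Prod>i<m. q t (y i) * q t0 (x i)) \<le> (\<Prod>i<m. q t (x i) * q t0 (y i))"
  proof (rule prod_mono, intro conjI)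
    fix i assume i: "i \<in> {..<m}"
    show "0 \<le> q t (y i) * q t0 (x i)" by (simp add: q_nonneg)
    show "q t (y i) * q t0 (x i) \<le> q t (x i) * q t0 (y i)"
      unfolding q_def c0 using i rng xy cos_ge_minus_one by (intro quad_factor_mono[OF A]) auto
  qed
  then have "(K\<^sup>2 * L\<^sup>2 * w t * w t0) * (\<Prod>i<m. q t (y i) * q t0 (x i)) \<le> (K\<^sup>2 * L\<^sup>2 * w t * w t0) * (\<Prod>i<m. q t (x i) * q t0 (y i))"
    using w_pos[of t] w_pos[of t0] by (intro mult_left_mono) auto
  then have "F lam t0 * F mu t \<le> F lam t * F mu t0"
    unfolding Flam Fmu prod.distrib by (simp only: mult_ac)
  moreover have "F lam t0 * F mu t0 \<le> F lam t0 * F mu t"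
    using le unfolding F_def by (intro mult_left_mono power_mono) auto
  ultimately have "F lam t0 * F mu t0 \<le> F lam t * F mu t0" by linarith
  moreover have "F mu t0 > 0"
    unfolding Fmu using S(4) w_pos[of t0] q0 rng by (intro mult_pos_pos prod_pos) auto
  ultimately have "F lam t0 \<le> F lam t" by simp
  then show ?thesis unfolding F_def by (rule power2_le_imp_le) simp
qed

text \<open>The square of rho_2^* is 2 + sqrt 3, the larger root of x^2 - 4x + 1; with x = rho^2
  this quadratic is nonnegative exactly when rho^2 + rho^-2 >= 4.\<close>

lemma rho_star_bounds:
  assumes "rho \<ge> (sqrt 2 + sqrt 6) / 2"
  shows "rho \<ge> 1" "rho\<^sup>2 + 1 / rho\<^sup>2 \<ge> 4"
proof -
  have s: "sqrt 2 \<ge> 1" "sqrt 6 \<ge> 1" by simp_all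
  have "(1 + 1) / 2 \<le> (sqrt 2 + sqrt 6) / 2" by (intro divide_right_mono add_mono s) simp
  from order.trans[OF this assms] show "rho \<ge> 1" by simp
  have "((sqrt 2 + sqrt 6) / 2)\<^sup>2 \<le> rho\<^sup>2" using assms s by (intro power_mono) auto
  moreover have "sqrt 2 * sqrt 6 = 2 * sqrt 3"
    using real_sqrt_mult[of 4 3] by (simp add: real_sqrt_mult[symmetric])
  then have "((sqrt 2 + sqrt 6) / 2)\<^sup>2 = 2 + sqrt 3" by (simp add: power2_eq_square algebra_simps)
  ultimately have "rho\<^sup>2 - 2 \<ge> sqrt 3" by simp
  then have "(rho\<^sup>2 - 2)\<^sup>2 \<ge> (sqrt 3)\<^sup>2" by (rule power_mono) simp
  then have "rho\<^sup>2 * rho\<^sup>2 + 1 \<ge> 4 * rho\<^sup>2" by (simp add: power2_eq_square algebra_simps)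
  moreover have "rho\<^sup>2 > 0" using \<open>rho \<ge> 1\<close> by simp
  ultimately show "rho\<^sup>2 + 1 / rho\<^sup>2 \<ge> 4" by (simp add: field_simps)
qed

lemma bernstein_ellipse_eq: "bernstein_ellipse rho = ellipse_point rho ` {0..<2*pi}"
  by (simp add: bernstein_ellipse_def ellipse_point_def)

theorem mainTheorem7:
  fixes rho lam :: real and n :: nat
  assumes "rho \<ge> (sqrt 2 + sqrt 6) / 2"
    and "n \<ge> 2"
    and "lam > 1 \<or> (0 < lam \<and> lam < 1 \<and> odd n)"
  shows "\<And>s::complex. s \<in> {1, -1} \<Longrightarrow>
           s * \<i> * complex_of_real ((rho - 1 / rho) / 2) \<in> bernstein_ellipse rho \<and>
           (\<forall>z\<in>bernstein_ellipse rho.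
              norm (gegenbauerC n lam (s * \<i> * complex_of_real ((rho - 1 / rho) / 2)))
                \<le> norm (gegenbauerC n lam z))"
proof -
  fix s :: complex assume s: "s \<in> {1, -1}"
  have rho: "rho \<ge> 1" "rho\<^sup>2 + 1 / rho\<^sup>2 \<ge> 4" "rho > 0"
    using rho_star_bounds[OF assms(1)] by auto
  have cis32: "cis (3 * pi / 2) = - \<i>"
    using cos_3over2_pi sin_3over2_pi by (simp add: complex_eq_iff)
  \<comment> \<open>For s = -1 the angle is 3 pi / 2 and not - pi / 2, to stay in the parameter
    range of the ellipse.\<close>
  define t0 where "t0 = (if s = 1 then pi / 2 else 3 * pi / 2)"
  have t0: "cos t0 = 0" "t0 \<in> {0..<2*pi}" "cis t0 = s * \<i>"
    using s cos_3over2_pi pi_gt_zero by (auto simp: t0_def cis32)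
  have z0: "s * \<i> * complex_of_real ((rho - 1 / rho) / 2) = ellipse_point rho t0"
    unfolding ellipse_point_def t0(3) using s rho(3) by (auto simp: inverse_eq_divide field_simps)
  have "cmod (jacobi_sum n (real n + lam - 1/2) (ellipse_point rho t0)) \<le> cmod (jacobi_sum n (real n + lam - 1/2) (ellipse_point rho t))" for t
  proof (cases "lam > 1")
    case True
    show ?thesis
      by (rule jacobi_sum_ellipse_ratio_mono[OF rho(3,2), of 1])
         (use True t0(1) chebyshev_U_minimum[OF rho(1,2) t0(1), of n t] in \<open>simp_all add: add.commute\<close>)
  next
    case False
    then have "odd n" "0 < lam" using assms(3) by auto
    then show ?thesis
      by - (rule jacobi_sum_ellipse_ratio_mono[OF rho(3,2), of 0],
        use t0(1) chebyshev_T_minimum[OF rho(3) _ t0(1), of n t] in auto)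
  qed
  \<comment> \<open>The Gamma quotient is constant in z, so the inequality is just scaled by its
    norm.\<close>
  then have "norm (gegenbauerC n lam (ellipse_point rho t0)) \<le> norm (gegenbauerC n lam (ellipse_point rho t))" for t
    unfolding gegenbauerC_eq norm_mult by (intro mult_left_mono norm_ge_zero)
  then show "s * \<i> * complex_of_real ((rho - 1 / rho) / 2) \<in> bernstein_ellipse rho \<and>
           (\<forall>z\<in>bernstein_ellipse rho.
              norm (gegenbauerC n lam (s * \<i> * complex_of_real ((rho - 1 / rho) / 2)))
                \<le> norm (gegenbauerC n lam z))"
    unfolding z0 bernstein_ellipse_eq using t0(2) by blast
qed

end
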